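(* Fix an odd integer $d\geq 3$. There exist real coefficients $w_0,w_1,\ldots,w_{(d-3)/2}$ and a continuous map $p:(0,1]\to\mathbb{R}$ such that for any spherically symmetric Borel probability measure $P$ on $\mathbb{R}^d$ admitting a bounded density (with respect to the Lebesgue measure) in a neighbourhood of the origin, and for $Z$ a random $d$-vector with law $P$, we have $$F_P^{\mathrm g}(su)=\bigg(\sum_{i=0}^{\frac{d-3}{2}}\Big(\mathbb{E}\Big[\frac{1}{\|Z\|^{2i+1}}\Big]w_i s^{2i+1}\Big)+\mathbb{E}\Big[p\Big(\frac{\|Z\|}{s}\Big)\mathbb{I}\big[\|Z\|\leq s\big]\Big]\bigg)u$$ for all $s>0$ and all $u\in\mathbb{S}^{d-1}$.
   Context: $\mathbb{S}^{d-1}$ is the unit sphere of $\mathbb{R}^d$. $P$ is spherically symmetric if $P[OA]=P[A]$ for all Borel subsets $A\subset\mathbb{R}^d$ and all $d\times d$ orthogonal matrices $O$. The geometric cdf of $P$ is $F_P^{\mathrm g}(x)=\mathbb{E}\big[\frac{x-Z}{\|x-Z\|}\mathbb{I}[Z\neq x]\big]$, with $Z\sim P$. The event $Z=0$ has probability $0$ under the density assumption, so $p(\|Z\|/s)\mathbb{I}[\|Z\|\le s]$ is defined almost surely. *)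

theory Defs
  imports "HOL-Probability.Probability"
begin

definition spherically_symmetric :: "(real ^ 'n) measure \<Rightarrow> bool" where
  "spherically_symmetric P \<longleftrightarrow>
     (\<forall>Q :: real ^ 'n ^ 'n. \<forall>A \<in> sets borel.
        orthogonal_matrix Q \<longrightarrow> measure P ((\<lambda>x. Q *v x) ` A) = measure P A)"

definition geometric_cdf :: "(real ^ 'n) measure \<Rightarrow> real ^ 'n \<Rightarrow> real ^ 'n" where
  "geometric_cdf P x =
     (\<integral>z. (if z \<noteq> x then (1 / norm (x - z)) *\<^sub>R (x - z) else 0) \<partial>P)"

text \<open>The density is only required on a neighbourhood of the origin: \<open>P\<close> may be singular
  elsewhere. The values of \<open>f\<close> outside \<open>U\<close> are irrelevant.\<close>

definition bounded_density_near_origin :: "(real ^ 'n) measure \<Rightarrow> bool" where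
  "bounded_density_near_origin P \<longleftrightarrow>
     (\<exists>U f C. open U \<and> 0 \<in> U \<and> f \<in> borel_measurable borel \<and>
        (\<forall>x \<in> U. 0 \<le> f x \<and> f x \<le> (C :: real)) \<and>
        (\<forall>A \<in> sets borel. A \<subseteq> U \<longrightarrow>
           emeasure P A = (\<integral>\<^sup>+ x \<in> A. ennreal (f x) \<partial>lborel)))"

end

theory Submission imports Defs begin

text \<open>
  Write \<open>d = 2 * m + 3\<close> for the dimension, \<open>V = Z / norm Z\<close> for the direction of \<open>Z\<close>, and let \<open>u\<close> be a
  unit vector. The component of the unit vector from \<open>Z\<close> to \<open>s u\<close> along \<open>u\<close> depends only on the
  ratio \<open>t = s / norm Z\<close> and on the cosine \<open>x = u \<bullet> V\<close>: it is \<open>(t - x) / sqrt (1 - 2 t x + t\<^sup>2)\<close>,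
  the \<open>sphere_kernel\<close> below. The other components average out, because the law is invariant under the
  reflection that fixes \<open>u\<close> and negates its orthogonal complement (\<open>geometric_cdf_parallel\<close>).

  Spherical symmetry makes the direction independent of the norm, and gives the cosine the density
  proportional to \<open>(1 - x\<^sup>2) ^ m\<close> on \<open>{-1..1}\<close>. Hence the expected component is \<open>\<E> (G (s / norm Z))\<close>,
  where \<open>G t\<close>, the \<open>sphere_mean\<close> of the kernel, is a universal function of \<open>t\<close>
  (\<open>geometric_cdf_radial\<close>). Both facts are obtained without surface measure. The law of the cosine is
  found by comparing the coefficients of \<open>\<epsilon>\<^sup>2\<close> in \<open>\<E> ((u + \<epsilon> e) \<bullet> V) ^ (2 j) = a (1 + \<epsilon>\<^sup>2) ^ j\<close>, which
  yields a recurrence that determines all moments (\<open>integral_cosine_power_recurrence\<close>); polynomials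
  are dense in the continuous functions. The independence comes from Fubini's theorem applied to \<open>Z\<close>
  and an independent copy of it that supplies a random direction (\<open>integral_radius_cosine\<close>).

  Odd dimension enters because \<open>m\<close> is then a natural number, so the weight is a polynomial. For
  \<open>0 < t < 1\<close> the integral of \<open>x ^ k / sqrt (1 - 2 t x + t\<^sup>2)\<close> over \<open>{-1..1}\<close> is a polynomial in \<open>t\<close> of
  degree at most \<open>k\<close> and of the parity of \<open>k\<close> (\<open>chord_moment_parity\<close>); in terms of Legendre
  polynomials, this is their orthogonality to lower powers. So on \<open>(0, 1)\<close>, that is for
  \<open>norm Z > s\<close>, the function \<open>G\<close> is an odd polynomial \<open>S\<close> of degree at most \<open>2 * m + 1 = d - 2\<close>, whose
  coefficients are the numbers \<open>w\<close>. The rest is carried by \<open>p \<rho> = G (1 / \<rho>) - S (1 / \<rho>)\<close> on \<open>norm Z \<le> s\<close>.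
  The moments of \<open>1 / norm Z\<close> that occur are finite since their order is below \<open>d\<close> and a bounded
  density gives small balls a mass of order at most \<open>r ^ d\<close> (\<open>integrable_inverse_norm_power\<close>).
\<close>

section \<open>Polynomials of definite parity\<close>

text \<open>
  On the unit interval the function agrees with a polynomial of degree at most \<open>k\<close> all of whose
  exponents have the parity of \<open>k\<close>. Only the interval \<open>(0, 1)\<close> matters, since the integrals below
  cease to be polynomials beyond \<open>t = 1\<close>.
\<close>

definition parity_polynomial :: "nat \<Rightarrow> (real \<Rightarrow> real) \<Rightarrow> bool" where
  "parity_polynomial k f \<longleftrightarrow>
     (\<exists>q. (\<forall>j. coeff q j \<noteq> 0 \<longrightarrow> j \<le> k \<and> even (k + j)) \<and> (\<forall>t\<in>{0<..<1}. f t = poly q t))"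

lemma parity_polynomial_minus:
  assumes "parity_polynomial k f" "parity_polynomial l g" "k \<le> l" "even (k + l)"
  shows "parity_polynomial l (\<lambda>t. f t - g t)"
proof -
  from assms(1) obtain p where p: "\<And>j. coeff p j \<noteq> 0 \<Longrightarrow> j \<le> k \<and> even (k + j)"
    "\<And>t. t \<in> {0<..<1} \<Longrightarrow> f t = poly p t" unfolding parity_polynomial_def by blast
  from assms(2) obtain q where q: "\<And>j. coeff q j \<noteq> 0 \<Longrightarrow> j \<le> l \<and> even (l + j)"
    "\<And>t. t \<in> {0<..<1} \<Longrightarrow> g t = poly q t" unfolding parity_polynomial_def by blast
  have "j \<le> l \<and> even (l + j)" if "coeff (p - q) j \<noteq> 0" for j
  proof (cases "coeff q j = 0")
    case True
    then have "coeff p j \<noteq> 0" using that by simp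
    then show ?thesis using p(1)[of j] assms(3,4) by auto
  qed (use q(1) in auto)
  then show ?thesis
    unfolding parity_polynomial_def using p(2) q(2) by (intro exI[of _ "p - q"]) auto
qed

lemma parity_polynomial_times:
  assumes "parity_polynomial k f"
  shows "parity_polynomial (Suc k) (\<lambda>t. t * f t)"
proof -
  from assms obtain p where p: "\<And>j. coeff p j \<noteq> 0 \<Longrightarrow> j \<le> k \<and> even (k + j)"
    "\<And>t. t \<in> {0<..<1} \<Longrightarrow> f t = poly p t" unfolding parity_polynomial_def by blast
  then show ?thesis
    unfolding parity_polynomial_def
    by (intro exI[of _ "pCons 0 p"]) (auto simp: coeff_pCons split: nat.splits)
qed

lemma parity_polynomial_odd_expansion:
  assumes "parity_polynomial (2 * m + 1) f"
  shows "\<exists>w. \<forall>t\<in>{0<..<1}. f t = (\<Sum>i=0..m. w i * t ^ (2 * i + 1))"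
proof -
  from assms obtain p where p: "\<And>j. coeff p j \<noteq> 0 \<Longrightarrow> j \<le> 2*m+1 \<and> even (2*m+1 + j)"
    "\<And>t. t \<in> {0<..<1} \<Longrightarrow> f t = poly p t" unfolding parity_polynomial_def by blast
  have deg: "degree p \<le> Suc (2 * m)"
    by (rule degree_le) (use p(1) in force)
  have even0: "coeff p (2 * i) = 0" for i
    using p(1)[of "2 * i"] by auto
  have "poly p t = (\<Sum>i=0..m. coeff p (2 * i + 1) * t ^ (2 * i + 1))" for t
    using sum.in_pairs_0[of "\<lambda>i. coeff p i * t ^ i" m]
    by (subst poly_as_sum_of_monoms'[OF deg, symmetric])
       (simp add: poly_sum poly_monom even0 atMost_atLeast0)
  then show ?thesis using p(2) by (intro exI[of _ "\<lambda>i. coeff p (2 * i + 1)"]) auto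
qed

section \<open>Integrals against the reciprocal chord\<close>

text \<open>The distance between a unit vector and \<open>t\<close> times another one that makes an angle of cosine \<open>x\<close>
  with it. On \<open>0 < t < 1\<close> it is bounded away from \<open>0\<close>, so everything is smooth there.\<close>

abbreviation chord :: "real \<Rightarrow> real \<Rightarrow> real" where
  "chord t x \<equiv> sqrt (1 - 2 * t * x + t\<^sup>2)"

lemma chord_sq_bound:
  fixes t x :: real
  assumes "t \<in> {0<..<1}" "x \<in> {-1..1}"
  shows "(1 - t)\<^sup>2 \<le> 1 - 2 * t * x + t\<^sup>2"
proof -
  have "t * x \<le> t" using assms by (auto intro: mult_left_le)
  then show ?thesis by (simp add: power2_eq_square algebra_simps)
qed

lemma chord_pos:
  fixes t x :: real
  assumes "t \<in> {0<..<1}" "x \<in> {-1..1}"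
  shows "0 < 1 - 2 * t * x + t\<^sup>2"
  using chord_sq_bound[OF assms] assms by (smt (verit) greaterThanLessThan_iff zero_less_power)

lemma continuous_on_div_chord:
  assumes "t \<in> {0<..<1}" "continuous_on {-1..1} f"
  shows "continuous_on {-1..1} (\<lambda>x. f x / chord t x)"
  using assms chord_pos[OF assms(1)]
  by (intro continuous_intros) (auto, fastforce)

lemma div_chord_integrable:
  assumes "t \<in> {0<..<1}" "continuous_on {-1..1} f"
  shows "(\<lambda>x. f x / chord t x) integrable_on {-1..1}"
  by (intro integrable_continuous_real continuous_on_div_chord assms)

definition chord_moment :: "nat \<Rightarrow> real \<Rightarrow> real" where
  "chord_moment k t = integral {-1..1} (\<lambda>x. x ^ k / chord t x)"

text \<open>Integrate the derivative of \<open>x ^ k * chord t x\<close>. As \<open>chord t\<close> has derivative \<open>- t / chord t\<close> and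
  its square is linear in \<open>x\<close>, only the moments of orders \<open>k\<close> and \<open>k - 1\<close> survive.\<close>

lemma chord_moment_recurrence:
  assumes t: "t \<in> {0<..<1}"
  shows "(2 * real k + 1) * t * chord_moment k t =
     real k * (1 + t\<^sup>2) * chord_moment (k - 1) t - ((1 - t) - (- 1) ^ k * (1 + t))"
proof -
  define f where "f x = real k * (1 + t\<^sup>2) * (x ^ (k - 1) / chord t x) -
      (2 * real k + 1) * t * (x ^ k / chord t x)" for x
  have int: "(\<lambda>x. x ^ j / chord t x) integrable_on {-1..1}" for j
    by (intro div_chord_integrable t continuous_intros)
  have "(f has_integral (1 ^ k * chord t 1 - (-1) ^ k * chord t (-1))) {-1..1}"
  proof (rule fundamental_theorem_of_calculus)
    fix x :: real assume x: "x \<in> {-1..1}"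
    have pos: "0 < 1 - 2 * t * x + t\<^sup>2" by (rule chord_pos[OF t x])
    have sq: "chord t x * chord t x = 1 - 2 * t * x + t\<^sup>2" using pos by simp
    have "((\<lambda>x. x ^ k * chord t x) has_real_derivative
        (real k * x ^ (k - 1) * chord t x + x ^ k * (- t / chord t x))) (at x within {-1..1})"
      using pos by (auto intro!: derivative_eq_intros simp: field_simps)
    moreover have "real k * x ^ (k - 1) * chord t x + x ^ k * (- t / chord t x) = f x"
    proof -
      have k1: "real k * x ^ k = real k * (x ^ (k - 1) * x)"
        by (cases k) (simp_all add: mult.commute)
      have "chord t x = (1 - 2 * t * x + t\<^sup>2) / chord t x"
        using pos sq by (simp add: field_simps)
      then have "real k * x ^ (k - 1) * chord t x + x ^ k * (- t / chord t x) =
          (real k * x ^ (k - 1) * (1 - 2 * t * x + t\<^sup>2) - t * x ^ k) / chord t x"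
        by (smt (verit, best) add_divide_distrib times_divide_eq_right mult_minus_right mult.commute minus_divide_left)
      also have "real k * x ^ (k - 1) * (1 - 2 * t * x + t\<^sup>2) - t * x ^ k =
          real k * (1 + t\<^sup>2) * x ^ (k - 1) - (2 * real k + 1) * t * x ^ k"
        using k1 by (simp add: algebra_simps)
      finally show ?thesis unfolding f_def by (simp add: diff_divide_distrib)
    qed
    ultimately show "((\<lambda>x. x ^ k * chord t x) has_vector_derivative f x) (at x within {-1..1})"
      by (simp add: has_real_derivative_iff_has_vector_derivative)
  qed simp
  moreover have "chord t 1 = 1 - t" "chord t (-1) = 1 + t"
  proof -
    have "1 - 2 * t * 1 + t\<^sup>2 = (1 - t)\<^sup>2" "1 - 2 * t * (-1) + t\<^sup>2 = (1 + t)\<^sup>2"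
      for t :: real by (simp_all add: power2_eq_square algebra_simps)
    then have "chord t 1 = \<bar>1 - t\<bar>" "chord t (-1) = \<bar>1 + t\<bar>"
      by (simp_all only: real_sqrt_abs)
    then show "chord t 1 = 1 - t" "chord t (-1) = 1 + t"
      using t by simp_all
  qed
  ultimately have "integral {-1..1} f = (1 - t) - (- 1) ^ k * (1 + t)"
    by (simp add: integral_unique)
  moreover have "integral {-1..1} f = real k * (1 + t\<^sup>2) * chord_moment (k - 1) t -
      (2 * real k + 1) * t * chord_moment k t"
    unfolding f_def chord_moment_def
    by (subst integral_diff) (auto intro!: integrable_on_mult_right int simp del: times_divide_eq_right)
  ultimately show ?thesis by simp
qed

text \<open>A bound that is uniform as \<open>t\<close> tends to \<open>0\<close>; it rules out a pole at \<open>0\<close> when the recurrence is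
  divided by \<open>t\<close>.\<close>

lemma chord_moment_bounded:
  assumes t: "t \<in> {0<..<1/2}"
  shows "\<bar>chord_moment k t\<bar> \<le> 4"
proof -
  have t': "t \<in> {0<..<1}" using t by auto
  have "norm (integral {-1..1} (\<lambda>x. x ^ k / chord t x)) \<le> 2 * (1 - (-1))"
  proof (rule integral_bound)
    fix x :: real assume x: "x \<in> {-1..1}"
    have "(1/2)\<^sup>2 \<le> (1 - t)\<^sup>2" by (rule power_mono) (use t in auto)
    then have "(1/2)\<^sup>2 \<le> 1 - 2 * t * x + t\<^sup>2" using chord_sq_bound[OF t' x] by linarith
    then have c: "1/2 \<le> chord t x" by (rule real_le_rsqrt)
    have "\<bar>x\<bar> ^ k \<le> 1" using x by (intro power_le_one) auto
    then have "\<bar>x\<bar> ^ k / chord t x \<le> 1 / (1/2)" using c by (intro frac_le) auto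
    then show "norm (x ^ k / chord t x) \<le> 2" using c by (simp add: power_abs abs_divide)
  qed (auto intro!: continuous_on_div_chord t' continuous_intros)
  then show ?thesis unfolding chord_moment_def by simp
qed

text \<open>
  In the recurrence, \<open>(1 + t\<^sup>2)\<close> raises the degree from \<open>k\<close> to \<open>k + 2\<close> and the division by \<open>t\<close> lowers it
  to \<open>k + 1\<close>. The division is exact: the right-hand side is \<open>t\<close> times a bounded function near \<open>0\<close>, so
  it has no constant term.
\<close>

lemma chord_moment_parity: "parity_polynomial k (chord_moment k)"
proof (induction k)
  case 0
  have "chord_moment 0 t = poly [:2:] t" if t: "t \<in> {0<..<1}" for t
    using chord_moment_recurrence[OF t, of 0] t by (simp add: field_simps)
  then show ?case unfolding parity_polynomial_def
    by (intro exI[of _ "[:2:]"]) (auto simp: coeff_pCons split: nat.splits)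
next
  case (Suc k)
  then obtain q where q: "\<And>j. coeff q j \<noteq> 0 \<Longrightarrow> j \<le> k \<and> even (k + j)"
    "\<And>t. t \<in> {0<..<1} \<Longrightarrow> chord_moment k t = poly q t"
    unfolding parity_polynomial_def by blast
  define N where "N = smult (real (Suc k)) (q + monom 1 2 * q) -
      ([:1, -1:] - smult ((-1) ^ Suc k) [:1, 1:])"
  have N: "poly N t = (2 * real (Suc k) + 1) * t * chord_moment (Suc k) t"
    if t: "t \<in> {0<..<1}" for t
    unfolding chord_moment_recurrence[OF t] N_def
    by (simp add: q(2)[OF t] poly_monom algebra_simps)
  have N0: "poly N 0 = 0"
  proof -
    have "((\<lambda>t. poly N t) \<longlongrightarrow> poly N 0) (at_right 0)"
      by (intro tendsto_intros)
    moreover have "((\<lambda>t. poly N t) \<longlongrightarrow> 0) (at_right 0)"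
    proof (rule Lim_null_comparison)
      show "\<forall>\<^sub>F t in at_right 0. norm (poly N t) \<le> (2 * real (Suc k) + 1) * t * 4"
        unfolding eventually_at_right_field
      proof (intro exI[of _ "1/2"] conjI allI impI)
        fix t :: real assume t: "0 < t" "t < 1/2"
        have "\<bar>chord_moment (Suc k) t\<bar> \<le> 4" using t by (intro chord_moment_bounded) auto
        then have "(2 * real (Suc k) + 1) * t * \<bar>chord_moment (Suc k) t\<bar> \<le> (2 * real (Suc k) + 1) * t * 4"
          using t by (intro mult_left_mono) auto
        then show "norm (poly N t) \<le> (2 * real (Suc k) + 1) * t * 4"
          using t by (simp add: N abs_mult)
      qed simp
      show "((\<lambda>t. (2 * real (Suc k) + 1) * t * 4) \<longlongrightarrow> 0) (at_right 0)"
        by (auto intro!: tendsto_eq_intros)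
    qed
    ultimately show ?thesis by (rule tendsto_unique[rotated]) simp
  qed
  \<comment> \<open>Dropping the vanishing constant coefficient of \<open>N\<close> is the division by \<open>t\<close>.\<close>
  obtain a r where ar: "N = pCons a r" by (cases N)
  have a: "a = 0" using N0 by (simp add: ar)
  define p where "p = smult (1 / (2 * real (Suc k) + 1)) r"
  have "chord_moment (Suc k) t = poly p t" if t: "t \<in> {0<..<1}" for t
  proof -
    have "t * poly r t = t * ((2 * real (Suc k) + 1) * chord_moment (Suc k) t)"
      using N[OF t] by (simp add: ar a algebra_simps)
    then have "poly r t = (2 * real (Suc k) + 1) * chord_moment (Suc k) t" using t by simp
    then show ?thesis by (simp add: p_def field_simps)
  qed
  moreover have "j \<le> Suc k \<and> even (Suc k + j)" if "coeff p j \<noteq> 0" for j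
  proof -
    have "coeff N (Suc j) \<noteq> 0" using that by (simp add: p_def ar)
    then have "coeff q (Suc j) \<noteq> 0 \<or> (j \<ge> 1 \<and> coeff q (j - 1) \<noteq> 0) \<or> (j = 0 \<and> odd k)"
      unfolding N_def
      by (auto simp: coeff_monom_mult coeff_pCons split: nat.splits if_splits)
    then show ?thesis using q(1)[of "Suc j"] q(1)[of "j - 1"] by auto
  qed
  ultimately show ?case unfolding parity_polynomial_def by blast
qed

text \<open>Each factor \<open>1 - x\<^sup>2\<close> of the weight turns a moment of order \<open>k\<close> into the difference of those of
  orders \<open>k\<close> and \<open>k + 2\<close>, which raises the degree by \<open>2\<close> and keeps the parity.\<close>

lemma ultraspherical_chord_moment_parity:
  "parity_polynomial (2 * m + k) (\<lambda>t. integral {-1..1} (\<lambda>x. x ^ k * (1 - x\<^sup>2) ^ m / chord t x))"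
proof (induction m arbitrary: k)
  case 0
  then show ?case using chord_moment_parity[of k] by (simp add: chord_moment_def[abs_def])
next
  case (Suc m)
  have "parity_polynomial (2 * m + (k + 2))
     (\<lambda>t. integral {-1..1} (\<lambda>x. x ^ k * (1 - x\<^sup>2) ^ m / chord t x) -
          integral {-1..1} (\<lambda>x. x ^ (k + 2) * (1 - x\<^sup>2) ^ m / chord t x))"
    by (rule parity_polynomial_minus[OF Suc Suc]) auto
  moreover have "integral {-1..1} (\<lambda>x. x ^ k * (1 - x\<^sup>2) ^ Suc m / chord t x) =
     integral {-1..1} (\<lambda>x. x ^ k * (1 - x\<^sup>2) ^ m / chord t x) -
          integral {-1..1} (\<lambda>x. x ^ (k + 2) * (1 - x\<^sup>2) ^ m / chord t x)"
    if t: "t \<in> {0<..<1}" for t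
  proof -
    have int: "(\<lambda>x. x ^ j * (1 - x\<^sup>2) ^ m / chord t x) integrable_on {-1..1}" for j
      by (intro div_chord_integrable t continuous_intros)
    have "x ^ k * (1 - x\<^sup>2) ^ Suc m / chord t x =
        x ^ k * (1 - x\<^sup>2) ^ m / chord t x - x ^ (k + 2) * (1 - x\<^sup>2) ^ m / chord t x" for x
      unfolding diff_divide_distrib[symmetric]
      by (simp add: left_diff_distrib right_diff_distrib power2_eq_square mult_ac)
    then show ?thesis by (simp only: integral_diff[OF int int])
  qed
  ultimately show ?case unfolding parity_polynomial_def by (simp add: add.commute)
qed

text \<open>The component along \<open>u\<close> of the unit vector pointing from a point \<open>v\<close> of the unit sphere to \<open>t u\<close>,
  where \<open>x = u \<bullet> v\<close>. At \<open>t = x = 1\<close> the two points coincide and \<open>0 / 0 = 0\<close> gives the intended value.\<close>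

definition sphere_kernel :: "real \<Rightarrow> real \<Rightarrow> real" where
  "sphere_kernel t x = (t - x) / chord t x"

lemma sphere_kernel_integral_expansion:
  "\<exists>w. \<forall>t\<in>{0<..<1}. integral {-1..1} (\<lambda>x. sphere_kernel t x * (1 - x\<^sup>2) ^ m) =
     (\<Sum>i=0..m. w i * t ^ (2 * i + 1))"
proof -
  let ?I = "\<lambda>k t. integral {-1..1} (\<lambda>x. x ^ k * (1 - x\<^sup>2) ^ m / chord t x)"
  have "parity_polynomial (2 * m + 1) (\<lambda>t. t * ?I 0 t - ?I 1 t)"
    using parity_polynomial_minus[OF parity_polynomial_times[OF
        ultraspherical_chord_moment_parity[of m 0]] ultraspherical_chord_moment_parity[of m 1]]
    by simp
  moreover have "integral {-1..1} (\<lambda>x. sphere_kernel t x * (1 - x\<^sup>2) ^ m) = t * ?I 0 t - ?I 1 t"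
    if t: "t \<in> {0<..<1}" for t
  proof -
    have int: "(\<lambda>x. x ^ j * (1 - x\<^sup>2) ^ m / chord t x) integrable_on {-1..1}" for j
      by (intro div_chord_integrable t continuous_intros)
    have "sphere_kernel t x * (1 - x\<^sup>2) ^ m =
        t * (x ^ 0 * (1 - x\<^sup>2) ^ m / chord t x) - x ^ 1 * (1 - x\<^sup>2) ^ m / chord t x" for x
      by (simp add: sphere_kernel_def diff_divide_distrib left_diff_distrib)
    then show ?thesis
      by (simp only: integral_diff[OF integrable_on_mult_right[OF int] int] integral_mult_right)
  qed
  ultimately have "parity_polynomial (2 * m + 1)
     (\<lambda>t. integral {-1..1} (\<lambda>x. sphere_kernel t x * (1 - x\<^sup>2) ^ m))"
    unfolding parity_polynomial_def by simp
  then show ?thesis by (rule parity_polynomial_odd_expansion)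
qed

lemma square_le_1: "x \<in> {-1..1} \<Longrightarrow> x\<^sup>2 \<le> 1" for x :: real
  by (auto simp: abs_square_le_1 abs_le_iff)

lemma chord_radicand: "1 - 2 * t * x + t\<^sup>2 = (t - x)\<^sup>2 + (1 - x\<^sup>2)" for t x :: real
  by (simp add: power2_eq_square algebra_simps)

text \<open>By Pythagoras' theorem: \<open>t - x\<close> is a leg of a right triangle with hypotenuse \<open>chord t x\<close>, whose
  other leg has length \<open>sqrt (1 - x\<^sup>2)\<close>.\<close>

lemma abs_sphere_kernel_le:
  assumes "x \<in> {-1..1}"
  shows "\<bar>sphere_kernel t x\<bar> \<le> 1"
proof -
  have "x\<^sup>2 \<le> 1" using assms by (rule square_le_1)
  then have "\<bar>t - x\<bar> \<le> chord t x"
    unfolding chord_radicand by (intro real_le_rsqrt) simp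
  then show ?thesis
    by (auto simp: sphere_kernel_def abs_divide divide_le_eq_1)
qed

text \<open>The chord vanishes only at \<open>t = x = 1\<close> and \<open>t = x = -1\<close>. For these \<open>t\<close> the kernel equals
  \<open>t * sqrt ((1 - t x) / 2)\<close>, which tends to the value \<open>0\<close> that division by zero supplies.\<close>

lemma continuous_on_sphere_kernel: "continuous_on {-1..1} (sphere_kernel t)"
proof (cases "\<bar>t\<bar> = 1")
  case False
  have "0 < (t - x)\<^sup>2 + (1 - x\<^sup>2)" if "x \<in> {-1..1}" for x
  proof (cases "x\<^sup>2 = 1")
    case True
    then have "t - x \<noteq> 0" using False by (auto simp: power2_eq_1_iff)
    then show ?thesis using True by simp
  next
    case F: False
    moreover have "x\<^sup>2 \<le> 1" using that by (rule square_le_1)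
    ultimately show ?thesis by (smt (verit) zero_le_power2)
  qed
  then show ?thesis
    unfolding sphere_kernel_def[abs_def] chord_radicand
    by (intro continuous_intros) (metis real_sqrt_eq_zero_cancel_iff less_irrefl)
next
  case True
  have "sphere_kernel t x = t * sqrt ((1 - t * x) / 2)" if "x \<in> {-1..1}" for x
  proof -
    have tt: "t * t = 1" using True by (auto simp: abs_if split: if_splits)
    have "t * x \<le> 1" using that True by (auto simp: abs_if split: if_splits)
    define y where "y = 1 - t * x"
    have y: "y \<ge> 0" using \<open>t * x \<le> 1\<close> by (simp add: y_def)
    have "t - x = t * y" using tt by (simp add: y_def algebra_simps mult.assoc[symmetric])
    moreover have "1 - 2 * t * x + t\<^sup>2 = 2 * y" using tt by (simp add: y_def power2_eq_square)
    moreover have "y / sqrt (2 * y) = sqrt (y / 2)"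
    proof -
      have "y / sqrt (2 * y) = sqrt y * sqrt y / (sqrt 2 * sqrt y)"
        using y by (simp add: real_sqrt_mult)
      also have "\<dots> = sqrt y / sqrt 2"
        by (metis div_0 mult_eq_0_iff nonzero_mult_divide_mult_cancel_right)
      finally show ?thesis by (simp add: real_sqrt_divide)
    qed
    ultimately show ?thesis unfolding sphere_kernel_def y_def[symmetric]
      by (metis times_divide_eq_right)
  qed
  moreover have "continuous_on {-1..1} (\<lambda>x. t * sqrt ((1 - t * x) / 2))"
    by (intro continuous_intros) auto
  ultimately show ?thesis by (subst continuous_on_cong[OF refl]) auto
qed

section \<open>The mean of a function of one coordinate over a sphere\<close>

text \<open>
  The coordinate \<open>u \<bullet> V\<close> of a uniform point \<open>V\<close> on the unit sphere of dimension \<open>d\<close> has density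
  proportional to \<open>(1 - x\<^sup>2) ^ ((d - 3) / 2)\<close>, so this is the mean of \<open>f (u \<bullet> V)\<close> in dimension
  \<open>2 * m + 3\<close>.
\<close>

definition sphere_mean :: "nat \<Rightarrow> (real \<Rightarrow> real) \<Rightarrow> real" where
  "sphere_mean m f = integral {-1..1} (\<lambda>x. f x * (1 - x\<^sup>2) ^ m) / integral {-1..1} (\<lambda>x. (1 - x\<^sup>2) ^ m)"

lemma abs_ultraspherical_weight_le:
  assumes "x \<in> {-1..1}"
  shows "\<bar>(1 - x\<^sup>2) ^ m\<bar> \<le> (1::real)"
  using square_le_1[OF assms] by (simp add: power_le_one)

lemma ultraspherical_mass_pos: "integral {-1..1} (\<lambda>x::real. (1 - x\<^sup>2) ^ m) > 0"
proof -
  let ?f = "\<lambda>x::real. (1 - x\<^sup>2) ^ m"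
  have nn: "0 \<le> ?f x" if "x \<in> {-1..1}" for x
    using square_le_1[OF that] by simp
  have int: "?f integrable_on {-1..1}" by (intro integrable_continuous_real continuous_intros)
  have "integral {-1..1} ?f \<noteq> 0"
  proof
    assume "integral {-1..1} ?f = 0"
    then have "(?f has_integral 0) (cbox (-1) 1)"
      using int by (metis box_real(2) has_integral_integral)
    then have "?f 0 = 0"
      by (rule has_integral_0_cbox_imp_0[rotated 2]) (auto intro!: continuous_intros nn)
    then show False by simp
  qed
  moreover have "integral {-1..1} ?f \<ge> 0" by (intro integral_nonneg int nn)
  ultimately show ?thesis by simp
qed

text \<open>By dominated convergence. The open interval is used because for \<open>\<bar>x\<bar> < 1\<close> the chord never
  vanishes, while at \<open>x = 1\<close> the kernel jumps as \<open>t\<close> passes \<open>1\<close>.\<close>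

lemma continuous_on_sphere_mean_kernel:
  "continuous_on UNIV (\<lambda>t. sphere_mean m (sphere_kernel t))"
proof -
  have "continuous_on UNIV (\<lambda>t. integral {-1..1} (\<lambda>x. sphere_kernel t x * (1 - x\<^sup>2) ^ m))"
    unfolding continuous_on_sequentially
  proof (intro ballI allI impI, elim conjE)
    fix T :: "nat \<Rightarrow> real" and t
    assume T: "T \<longlonglongrightarrow> t"
    have "(\<lambda>k. integral {-1<..<1} (\<lambda>x. sphere_kernel (T k) x * (1 - x\<^sup>2) ^ m))
        \<longlonglongrightarrow> integral {-1<..<1} (\<lambda>x. sphere_kernel t x * (1 - x\<^sup>2) ^ m)"
    proof (rule dominated_convergence)
      fix k
      show "(\<lambda>x. sphere_kernel (T k) x * (1 - x\<^sup>2) ^ m) integrable_on {-1<..<1}"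
        unfolding integrable_on_open_interval_real
        by (intro integrable_continuous_real continuous_on_mult continuous_on_sphere_kernel continuous_intros)
    next
      show "(\<lambda>x. 1::real) integrable_on {-1<..<1::real}"
        by (subst integrable_on_open_interval_real) (rule integrable_const_ivl)
    next
      fix k and x :: real assume "x \<in> {-1<..<1}"
      then have x: "x \<in> {-1..1}" by simp
      show "norm (sphere_kernel (T k) x * (1 - x\<^sup>2) ^ m) \<le> 1"
        using mult_mono[OF abs_sphere_kernel_le[OF x] abs_ultraspherical_weight_le[OF x]]
        by (simp add: abs_mult)
    next
      fix x :: real assume x: "x \<in> {-1<..<1}"
      have "x\<^sup>2 < 1" using x by (auto simp: abs_square_less_1 abs_less_iff)
      then have "0 < 1 - 2 * t * x + t\<^sup>2"
        unfolding chord_radicand by (smt (verit) zero_le_power2)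
      then show "(\<lambda>k. sphere_kernel (T k) x * (1 - x\<^sup>2) ^ m) \<longlonglongrightarrow> sphere_kernel t x * (1 - x\<^sup>2) ^ m"
        unfolding sphere_kernel_def by (intro tendsto_intros T) auto
    qed
    then show "((\<lambda>t. integral {-1..1} (\<lambda>x. sphere_kernel t x * (1 - x\<^sup>2) ^ m)) \<circ> T)
        \<longlonglongrightarrow> integral {-1..1} (\<lambda>x. sphere_kernel t x * (1 - x\<^sup>2) ^ m)"
      by (simp add: integral_open_interval_real comp_def)
  qed
  then show ?thesis
    unfolding sphere_mean_def using ultraspherical_mass_pos[of m]
    by (intro continuous_on_divide continuous_on_const) auto
qed

text \<open>Integrate the derivative of \<open>x ^ k * (1 - x\<^sup>2) ^ (m + 1)\<close>, which vanishes at both ends. For \<open>k = 0\<close>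
  the truncated exponent \<open>k - 1\<close> is harmless, as its coefficient is \<open>0\<close>; that case says that the first
  moment vanishes.\<close>

lemma ultraspherical_moment_recurrence:
  "(real k + 2 * real m + 2) * integral {-1..1} (\<lambda>x. x ^ (k + 1) * (1 - x\<^sup>2) ^ m) =
     real k * integral {-1..1} (\<lambda>x::real. x ^ (k - 1) * (1 - x\<^sup>2) ^ m)"
proof -
  define f :: "real \<Rightarrow> real" where "f x = real k * (x ^ (k - 1) * (1 - x\<^sup>2) ^ m) -
      (real k + 2 * real m + 2) * (x ^ (k + 1) * (1 - x\<^sup>2) ^ m)" for x
  have int: "(\<lambda>x::real. x ^ j * (1 - x\<^sup>2) ^ m) integrable_on {-1..1}" for j
    by (intro integrable_continuous_real continuous_intros)
  have "(f has_integral (1 ^ k * (1 - 1\<^sup>2) ^ Suc m - (-1) ^ k * (1 - (-1)\<^sup>2) ^ Suc m)) {-1..1}"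
  proof (rule fundamental_theorem_of_calculus)
    fix x :: real
    have "((\<lambda>x. x ^ k * (1 - x\<^sup>2) ^ Suc m) has_real_derivative
        (real k * x ^ (k - 1) * (1 - x\<^sup>2) ^ Suc m + x ^ k * (real (Suc m) * (1 - x\<^sup>2) ^ m * (- 2 * x))))
        (at x within {-1..1})"
      by (auto intro!: derivative_eq_intros simp del: power_Suc)
    moreover have "real k * x ^ (k - 1) * (1 - x\<^sup>2) ^ Suc m + x ^ k * (real (Suc m) * (1 - x\<^sup>2) ^ m * (- 2 * x)) = f x"
      unfolding f_def by (cases k) (simp_all add: algebra_simps power2_eq_square)
    ultimately show "((\<lambda>x. x ^ k * (1 - x\<^sup>2) ^ Suc m) has_vector_derivative f x) (at x within {-1..1})"
      by (simp add: has_real_derivative_iff_has_vector_derivative)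
  qed simp
  then have "integral {-1..1} f = 0" by (simp add: integral_unique)
  moreover have "integral {-1..1} f = real k * integral {-1..1} (\<lambda>x. x ^ (k - 1) * (1 - x\<^sup>2) ^ m) -
      (real k + 2 * real m + 2) * integral {-1..1} (\<lambda>x. x ^ (k + 1) * (1 - x\<^sup>2) ^ m)"
    unfolding f_def
    by (simp only: integral_diff[OF integrable_on_mult_right[OF int] integrable_on_mult_right[OF int]]
        integral_mult_right)
  ultimately show ?thesis by simp
qed

lemma sphere_mean_power_recurrence:
  "(real k + 2 * real m + 2) * sphere_mean m (\<lambda>x. x ^ (k + 1)) = real k * sphere_mean m (\<lambda>x. x ^ (k - 1))"
  using ultraspherical_moment_recurrence[of k m]
  by (simp only: sphere_mean_def times_divide_eq_right)

lemma sphere_mean_one: "sphere_mean m (\<lambda>x. 1) = 1"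
  using ultraspherical_mass_pos[of m] by (simp add: sphere_mean_def)

lemma sphere_mean_odd_power: "odd k \<Longrightarrow> sphere_mean m (\<lambda>x. x ^ k) = 0"
proof (induction k rule: less_induct)
  case (less k)
  show ?case
  proof (cases "k = 1")
    case True
    then show ?thesis using sphere_mean_power_recurrence[of 0 m] by (simp add: add_eq_0_iff)
  next
    case False
    with less.prems have "k \<ge> 3" by presburger
    then have k: "k - 1 + 1 = k" "k - 1 - 1 = k - 2" "k - 2 < k" "odd (k - 2)"
      using less.prems by simp_all
    then show ?thesis using sphere_mean_power_recurrence[of "k - 1" m] less.IH[OF k(3,4)]
      by (simp add: add_eq_0_iff)
  qed
qed

lemma sphere_mean_polynomial:
  "sphere_mean m (\<lambda>x. \<Sum>i\<le>n. a i * x ^ i) = (\<Sum>i\<le>n. a i * sphere_mean m (\<lambda>x. x ^ i))"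
proof -
  have "integral {-1..1} (\<lambda>x. (\<Sum>i\<le>n. a i * x ^ i) * (1 - x\<^sup>2) ^ m) =
      integral {-1..1} (\<lambda>x. \<Sum>i\<le>n. a i * (x ^ i * (1 - x\<^sup>2) ^ m))"
    by (simp add: sum_distrib_right mult.assoc)
  also have "\<dots> = (\<Sum>i\<le>n. a i * integral {-1..1} (\<lambda>x. x ^ i * (1 - x\<^sup>2) ^ m))"
  proof (subst integral_sum)
    show "(\<lambda>x. a i * (x ^ i * (1 - x\<^sup>2) ^ m)) integrable_on {-1..1}" for i
      by (intro integrable_continuous_real continuous_intros)
  qed simp_all
  finally show ?thesis by (simp add: sphere_mean_def sum_divide_distrib)
qed

lemma sphere_mean_diff_le:
  assumes f: "continuous_on {-1..1} f" and g: "continuous_on {-1..1} g"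
    and le: "\<And>x. x \<in> {-1..1} \<Longrightarrow> \<bar>f x - g x\<bar> \<le> e"
  shows "\<bar>sphere_mean m f - sphere_mean m g\<bar> \<le> e"
proof -
  let ?w = "\<lambda>x::real. (1 - x\<^sup>2) ^ m"
  have fw: "(\<lambda>x. f x * ?w x) integrable_on {-1..1}" and gw: "(\<lambda>x. g x * ?w x) integrable_on {-1..1}"
    by (intro integrable_continuous_real continuous_intros f g)+
  have w: "?w integrable_on {-1..1}" by (intro integrable_continuous_real continuous_intros)
  have nn: "0 \<le> ?w x" if "x \<in> {-1..1}" for x
    using square_le_1[OF that] by simp
  have "norm (integral {-1..1} (\<lambda>x. f x * ?w x - g x * ?w x)) \<le> integral {-1..1} (\<lambda>x. e * ?w x)"
  proof (rule integral_norm_bound_integral)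
    fix x :: real assume x: "x \<in> {-1..1}"
    have "norm (f x * ?w x - g x * ?w x) = \<bar>f x - g x\<bar> * ?w x"
      using nn[OF x] by (simp add: left_diff_distrib[symmetric] abs_mult)
    also have "\<dots> \<le> e * ?w x" using le[OF x] nn[OF x] by (rule mult_right_mono)
    finally show "norm (f x * ?w x - g x * ?w x) \<le> e * ?w x" .
  qed (use w fw gw in \<open>auto intro: integrable_diff integrable_on_mult_right\<close>)
  then have "\<bar>integral {-1..1} (\<lambda>x. f x * ?w x) - integral {-1..1} (\<lambda>x. g x * ?w x)\<bar>
      \<le> e * integral {-1..1} ?w"
    by (simp add: integral_diff[OF fw gw])
  then show ?thesis using ultraspherical_mass_pos[of m]
    by (simp add: sphere_mean_def diff_divide_distrib[symmetric] abs_divide divide_le_eq)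
qed

text \<open>A law on a compact interval is determined by its moments: by Weierstrass' theorem, continuous
  functions are uniform limits of polynomials, and both sides are monotone, normalised and linear.\<close>

lemma expectation_eq_sphere_mean:
  assumes "prob_space M" and X: "X \<in> borel_measurable M"
    and range: "\<And>\<omega>. \<omega> \<in> space M \<Longrightarrow> X \<omega> \<in> {-1..1}"
    and moments: "\<And>k. (\<integral>\<omega>. X \<omega> ^ k \<partial>M) = sphere_mean m (\<lambda>x. x ^ k)"
    and f: "continuous_on {-1..1} f" "f \<in> borel_measurable borel"
  shows "(\<integral>\<omega>. f (X \<omega>) \<partial>M) = sphere_mean m f"
proof -
  interpret prob_space M by fact
  have *: "\<bar>(\<integral>\<omega>. f (X \<omega>) \<partial>M) - sphere_mean m f\<bar> \<le> e" if "e > 0" for e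
  proof -
    obtain g where g: "real_polynomial_function g" "\<And>x. x \<in> {-1..1} \<Longrightarrow> \<bar>f x - g x\<bar> < e / 2"
      using Stone_Weierstrass_real_polynomial_function[of "{-1..1}" f "e / 2"] f(1) \<open>e > 0\<close> by auto
    obtain a n where a: "g = (\<lambda>x. \<Sum>i\<le>n. a i * x ^ i)"
      using g(1) unfolding real_polynomial_function_iff_sum by blast
    have pw: "integrable M (\<lambda>\<omega>. X \<omega> ^ i)" for i
      by (rule integrable_const_bound[where B = 1])
         (use range X in \<open>auto simp: power_abs abs_le_iff intro!: AE_I2 power_le_one\<close>)
    have gi: "integrable M (\<lambda>\<omega>. g (X \<omega>))" unfolding a using pw by simp
    have "bounded (f ` {-1..1})"
      by (intro compact_imp_bounded compact_continuous_image f) simp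
    then obtain B where "\<forall>y\<in>f ` {-1..1}. norm y \<le> B" unfolding bounded_iff by blast
    then have B: "\<bar>f x\<bar> \<le> B" if "x \<in> {-1..1}" for x using that by simp
    have fi: "integrable M (\<lambda>\<omega>. f (X \<omega>))"
      by (rule integrable_const_bound[where B = B])
         (use range B f(2) X in \<open>auto intro!: AE_I2\<close>)
    have "\<bar>(\<integral>\<omega>. f (X \<omega>) \<partial>M) - (\<integral>\<omega>. g (X \<omega>) \<partial>M)\<bar> = \<bar>\<integral>\<omega>. f (X \<omega>) - g (X \<omega>) \<partial>M\<bar>"
      using fi gi by simp
    also have "\<dots> \<le> (\<integral>\<omega>. \<bar>f (X \<omega>) - g (X \<omega>)\<bar> \<partial>M)" by (rule integral_abs_bound)
    also have "\<dots> \<le> (\<integral>\<omega>. e / 2 \<partial>M)"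
      by (rule integral_mono) (use fi gi g(2) range in \<open>auto intro!: less_imp_le\<close>)
    also have "\<dots> = e / 2" by (simp add: prob_space)
    finally have 1: "\<bar>(\<integral>\<omega>. f (X \<omega>) \<partial>M) - (\<integral>\<omega>. g (X \<omega>) \<partial>M)\<bar> \<le> e / 2" .
    have "(\<integral>\<omega>. g (X \<omega>) \<partial>M) = sphere_mean m g"
      unfolding a sphere_mean_polynomial using pw by (simp add: moments)
    moreover have "\<bar>sphere_mean m f - sphere_mean m g\<bar> \<le> e / 2"
    proof (rule sphere_mean_diff_le[OF f(1)])
      show "continuous_on {-1..1} g" unfolding a by (intro continuous_intros)
    qed (rule less_imp_le[OF g(2)])
    ultimately show ?thesis using 1 by linarith
  qed
  define D where "D = \<bar>(\<integral>\<omega>. f (X \<omega>) \<partial>M) - sphere_mean m f\<bar>"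
  have "\<not> D > 0" using *[of "D / 2"] by (auto simp: D_def[symmetric])
  then show ?thesis by (simp add: D_def)
qed

section \<open>Spherically symmetric laws\<close>

lemma coeff_one_plus_square_power:
  "coeff ([:1, 0, 1:] ^ j :: real poly) 0 = 1 \<and> coeff ([:1, 0, 1:] ^ j :: real poly) 2 = real j"
  by (induction j) (auto simp: numeral_2_eq_2)

lemma cosine_range:
  fixes u z :: "'a::real_inner"
  assumes "norm u \<le> 1"
  shows "u \<bullet> z / norm z \<in> {-1..1}"
proof -
  from assms have "\<bar>u \<bullet> z\<bar> \<le> 1 * norm z"
    by (intro order_trans[OF Cauchy_Schwarz_ineq2] mult_right_mono) auto
  then have "\<bar>u \<bullet> z / norm z\<bar> \<le> 1" by (auto simp: abs_divide divide_le_eq_1)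
  then show ?thesis unfolding abs_le_iff atLeastAtMost_iff minus_le_iff[of _ 1] by blast
qed

lemma measurable_cosine [measurable]: "(\<lambda>z. u \<bullet> z / norm z) \<in> borel_measurable borel" for u :: "real ^ 'n"
  by measurable

lemma measurable_ratio_power: "(\<lambda>(a, b). (a / b) ^ k) \<in> borel_measurable (borel :: (real \<times> real) measure)"
  unfolding borel_prod[symmetric] by measurable

text \<open>The absence of an atom at the origin makes the direction \<open>z / norm z\<close> meaningful almost
  surely.\<close>

locale spherical_law = prob_space P for P :: "(real ^ 'n::finite) measure" +
  assumes sets_P [measurable_cong]: "sets P = sets borel"
    and symmetric: "spherically_symmetric P"
    and AE_nonzero: "AE z in P. z \<noteq> 0"
begin

text \<open>Symmetry is given through images, the pushforward is defined through preimages; the two meet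
  by passing to the inverse transformation, which is orthogonal too.\<close>

lemma distr_orthogonal:
  assumes T: "orthogonal_transformation T"
  shows "distr P borel T = P"
proof (rule measure_eqI)
  fix A assume "A \<in> sets (distr P borel T)"
  then have A: "A \<in> sets borel" by simp
  have [measurable]: "T \<in> borel_measurable borel"
    by (intro borel_measurable_continuous_onI linear_continuous_on linear_conv_bounded_linear[THEN iffD1]
        orthogonal_transformation_linear T)
  let ?S = "inv T"
  have S: "orthogonal_transformation ?S" by (rule orthogonal_transformation_inv[OF T])
  have "T -` A = ?S ` A"
    using orthogonal_transformation_bij[OF T] by (simp add: bij_vimage_eq_inv_image)
  also have "\<dots> = (\<lambda>x. matrix ?S *v x) ` A"
    using S by (simp add: orthogonal_transformation_linear matrix_works)
  finally have "T -` A = (\<lambda>x. matrix ?S *v x) ` A" .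
  then have "measure P (T -` A) = measure P A"
    using symmetric S A unfolding spherically_symmetric_def orthogonal_transformation_matrix by metis
  moreover have "space P = UNIV" using sets_eq_imp_space_eq[OF sets_P] by simp
  ultimately show "emeasure (distr P borel T) A = emeasure P A"
    using A by (simp add: emeasure_distr emeasure_eq_measure)
qed (simp add: sets_P)

lemma integral_orthogonal:
  fixes f :: "real ^ 'n \<Rightarrow> 'b::{banach, second_countable_topology}"
  assumes T: "orthogonal_transformation T" and f: "f \<in> borel_measurable borel"
  shows "(\<integral>z. f (T z) \<partial>P) = (\<integral>z. f z \<partial>P)"
proof -
  have [measurable]: "T \<in> borel_measurable borel"
    by (intro borel_measurable_continuous_onI linear_continuous_on linear_conv_bounded_linear[THEN iffD1]
        orthogonal_transformation_linear T)
  have "(\<integral>z. f z \<partial>distr P borel T) = (\<integral>z. f (T z) \<partial>P)"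
    by (rule integral_distr) (use f in measurable)
  then show ?thesis by (simp add: distr_orthogonal[OF T])
qed

text \<open>Orthogonal transformations act transitively on each sphere, so expectations of functions of the
  norm and of the component along \<open>u\<close> depend on \<open>u\<close> through its length only.\<close>

lemma integral_direction:
  fixes f :: "real \<Rightarrow> real \<Rightarrow> real"
  assumes "norm u = norm v" and f: "(\<lambda>(a, b). f a b) \<in> borel_measurable borel"
  shows "(\<integral>z. f (u \<bullet> z) (norm z) \<partial>P) = (\<integral>z. f (v \<bullet> z) (norm z) \<partial>P)"
proof -
  obtain T where T: "orthogonal_transformation T" "T v = u"
    using orthogonal_transformation_exists[of v u] assms(1) by metis
  have "(\<lambda>z. (u \<bullet> z, norm z)) \<in> borel_measurable borel" by measurable
  from measurable_compose[OF this f] have "(\<lambda>z. f (u \<bullet> z) (norm z)) \<in> borel_measurable borel" by simp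
  from integral_orthogonal[OF T(1) this] show ?thesis
    using T by (auto simp: orthogonal_transformation_def orthogonal_transformation_norm)
qed

lemma integrable_cosine_powers:
  fixes u v :: "real ^ 'n"
  assumes "norm u \<le> 1" "norm v \<le> 1"
  shows "integrable P (\<lambda>z. (u \<bullet> z / norm z) ^ k * (v \<bullet> z / norm z) ^ l)"
proof (rule integrable_const_bound[where B = 1])
  have "norm ((u \<bullet> z / norm z) ^ k * (v \<bullet> z / norm z) ^ l) \<le> 1 * 1" for z
  proof -
    have "\<bar>u \<bullet> z / norm z\<bar> \<le> 1" "\<bar>v \<bullet> z / norm z\<bar> \<le> 1"
      using cosine_range[OF assms(1), of z] cosine_range[OF assms(2), of z]
      unfolding abs_le_iff atLeastAtMost_iff minus_le_iff[of _ 1] by blast+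
    then show ?thesis
      unfolding real_norm_def abs_mult power_abs by (intro mult_mono power_le_one) simp_all
  qed
  then show "AE z in P. norm ((u \<bullet> z / norm z) ^ k * (v \<bullet> z / norm z) ^ l) \<le> 1" by simp
qed measurable

lemma integral_cosine_power_scale:
  assumes "norm u = 1"
  shows "(\<integral>z. (y \<bullet> z / norm z) ^ k \<partial>P) = norm y ^ k * (\<integral>z. (u \<bullet> z / norm z) ^ k \<partial>P)"
proof -
  have "(\<integral>z. (y \<bullet> z / norm z) ^ k \<partial>P) = (\<integral>z. ((norm y *\<^sub>R u) \<bullet> z / norm z) ^ k \<partial>P)"
    by (rule integral_direction[where f = "\<lambda>a b. (a / b) ^ k"]) (use assms measurable_ratio_power in auto)
  also have "\<dots> = (\<integral>z. norm y ^ k * (u \<bullet> z / norm z) ^ k \<partial>P)"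
    by (simp add: power_mult_distrib power_divide)
  finally show ?thesis by simp
qed

lemma integral_cosine_odd_power:
  assumes "odd k" shows "(\<integral>z. (u \<bullet> z / norm z) ^ k \<partial>P) = 0"
proof -
  have "(\<integral>z. (u \<bullet> z / norm z) ^ k \<partial>P) = (\<integral>z. ((- u) \<bullet> z / norm z) ^ k \<partial>P)"
    by (rule integral_direction[where f = "\<lambda>a b. (a / b) ^ k"]) (auto simp: measurable_ratio_power)
  also have "\<dots> = - (\<integral>z. (u \<bullet> z / norm z) ^ k \<partial>P)"
    using assms by simp
  finally show ?thesis by simp
qed

text \<open>
  For every \<open>\<epsilon>\<close>, the expectation of \<open>(X + \<epsilon> Y) ^ (2 * j + 2)\<close>, with \<open>X\<close> and \<open>Y\<close> the cosines along
  the orthogonal unit vectors \<open>u\<close> and \<open>e\<close>, is \<open>(1 + \<epsilon>\<^sup>2) ^ (j + 1)\<close> times that of \<open>X ^ (2 * j + 2)\<close>, as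
  \<open>u + \<epsilon> e\<close> has length \<open>sqrt (1 + \<epsilon>\<^sup>2)\<close>. Both sides are polynomials in \<open>\<epsilon>\<close>; the claim compares their
  coefficients of \<open>\<epsilon>\<^sup>2\<close>.
\<close>

lemma integral_orthogonal_cosines:
  assumes u: "norm u = 1" and e: "norm e = 1" and ue: "u \<bullet> e = 0"
  shows "(2 * real j + 1) * (\<integral>z. (u \<bullet> z / norm z) ^ (2 * j) * (e \<bullet> z / norm z)\<^sup>2 \<partial>P) =
     (\<integral>z. (u \<bullet> z / norm z) ^ (2 * j + 2) \<partial>P)"
proof -
  define X where "X z = u \<bullet> z / norm z" for z
  define Y where "Y z = e \<bullet> z / norm z" for z
  define n where "n = 2 * Suc j"
  have "2 \<le> n" by (simp add: n_def)
  define E where "E l = (\<integral>z. Y z ^ l * X z ^ (n - l) \<partial>P)" for l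
  define a where "a = (\<integral>z. X z ^ n \<partial>P)"
  have int: "integrable P (\<lambda>z. Y z ^ k * X z ^ l)" for k l
    unfolding X_def Y_def by (rule integrable_cosine_powers) (simp_all add: u e)
  define p where "p = (\<Sum>l\<le>n. monom (real (n choose l) * E l) l)"
  define q where "q = smult a ([:1, 0, 1:] ^ Suc j)"
  have "poly p \<epsilon> = poly q \<epsilon>" for \<epsilon>
  proof -
    have "((u + \<epsilon> *\<^sub>R e) \<bullet> z / norm z) ^ n = (\<Sum>l\<le>n. (real (n choose l) * \<epsilon> ^ l) * (Y z ^ l * X z ^ (n - l)))" for z
    proof -
      have "(u + \<epsilon> *\<^sub>R e) \<bullet> z / norm z = \<epsilon> * Y z + X z"
        by (simp add: X_def Y_def inner_add_left add_divide_distrib)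
      then show ?thesis by (simp add: binomial_ring power_mult_distrib mult_ac)
    qed
    then have "(\<integral>z. ((u + \<epsilon> *\<^sub>R e) \<bullet> z / norm z) ^ n \<partial>P) = (\<Sum>l\<le>n. (real (n choose l) * \<epsilon> ^ l) * E l)"
      using int by (simp add: E_def)
    moreover have "norm (u + \<epsilon> *\<^sub>R e) ^ n = (1 + \<epsilon>\<^sup>2) ^ Suc j"
    proof -
      have "(norm (u + \<epsilon> *\<^sub>R e))\<^sup>2 = u \<bullet> u + 2 * \<epsilon> * (u \<bullet> e) + \<epsilon>\<^sup>2 * (e \<bullet> e)"
        unfolding power2_norm_eq_inner by (simp add: algebra_simps inner_commute power2_eq_square)
      also have "\<dots> = 1 + \<epsilon>\<^sup>2" using u e ue by (simp add: dot_square_norm)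
      finally show ?thesis by (simp only: n_def power_mult)
    qed
    ultimately show ?thesis
      using integral_cosine_power_scale[OF u, of "u + \<epsilon> *\<^sub>R e" n]
      by (simp add: p_def q_def poly_sum poly_monom a_def X_def mult_ac power2_eq_square
          poly_power del: power_Suc)
  qed
  then have "p = q" by (simp add: poly_eq_poly_eq_iff[symmetric] fun_eq_iff)
  then have "coeff p 2 = coeff q 2" by simp
  moreover have "coeff p 2 = real (n choose 2) * E 2"
    using \<open>2 \<le> n\<close> by (simp add: p_def coeff_sum)
  moreover have "coeff q 2 = a * real (Suc j)"
    unfolding q_def using coeff_one_plus_square_power[of "Suc j"] by simp
  moreover have "real (n choose 2) = real (Suc j) * (2 * real j + 1)"
  proof -
    have "n choose 2 = Suc j * (2 * j + 1)" by (simp add: n_def choose_two)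
    then show ?thesis by (simp only: of_nat_mult of_nat_add of_nat_numeral of_nat_1)
  qed
  ultimately have "real (Suc j) * ((2 * real j + 1) * E 2) = real (Suc j) * a"
    by (simp add: mult_ac)
  then have "(2 * real j + 1) * E 2 = a" by simp
  then show ?thesis by (simp add: E_def a_def n_def X_def Y_def mult.commute)
qed

text \<open>Sum the preceding identity over the coordinate directions orthogonal to a given one: the squared
  cosines along all coordinate axes add up to \<open>1\<close>.\<close>

lemma integral_cosine_power_recurrence:
  fixes u :: "real ^ 'n"
  assumes u: "norm u = 1"
  shows "(2 * real j + real CARD('n)) * (\<integral>z. (u \<bullet> z / norm z) ^ (2 * j + 2) \<partial>P) =
     (2 * real j + 1) * (\<integral>z. (u \<bullet> z / norm z) ^ (2 * j) \<partial>P)"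
proof -
  fix i0 :: 'n
  let ?Y = "\<lambda>i z. axis i 1 \<bullet> z / norm z :: real"
  define a where "a k = (\<integral>z. ?Y i0 z ^ k \<partial>P)" for k
  have a: "(\<integral>z. (u \<bullet> z / norm z) ^ k \<partial>P) = a k" for k
    using integral_cosine_power_scale[of "axis i0 1" u k] u by (simp add: a_def)
  have int: "integrable P (\<lambda>z. ?Y i z ^ k * ?Y i' z ^ l)" for i i' k l
    by (rule integrable_cosine_powers) simp_all
  have int1: "integrable P (\<lambda>z. ?Y i z ^ k)" for i k
    using int[of i k i 0] by simp
  have "real (CARD('n) - 1) * a (2 * j + 2) =
     (\<Sum>i\<in>UNIV - {i0}. (2 * real j + 1) * (\<integral>z. ?Y i0 z ^ (2 * j) * (?Y i z)\<^sup>2 \<partial>P))"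
    by (subst sum.cong[OF refl integral_orthogonal_cosines])
       (auto simp: a_def card_Diff_singleton inner_axis_axis)
  also have "\<dots> = (2 * real j + 1) * (\<integral>z. (\<Sum>i\<in>UNIV - {i0}. ?Y i0 z ^ (2 * j) * (?Y i z)\<^sup>2) \<partial>P)"
    by (subst Bochner_Integration.integral_sum) (auto simp: int sum_distrib_left)
  also have "(\<integral>z. (\<Sum>i\<in>UNIV - {i0}. ?Y i0 z ^ (2 * j) * (?Y i z)\<^sup>2) \<partial>P) =
      (\<integral>z. ?Y i0 z ^ (2 * j) - ?Y i0 z ^ (2 * j + 2) \<partial>P)"
  proof (rule integral_cong_AE)
    show "AE z in P. (\<Sum>i\<in>UNIV - {i0}. ?Y i0 z ^ (2 * j) * (?Y i z)\<^sup>2) = ?Y i0 z ^ (2 * j) - ?Y i0 z ^ (2 * j + 2)"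
      using AE_nonzero
    proof eventually_elim
      case (elim z)
      have "(\<Sum>i\<in>UNIV. (?Y i z)\<^sup>2) = (\<Sum>i\<in>UNIV. z $ i * z $ i) / (norm z)\<^sup>2"
        by (simp add: inner_axis' power_divide sum_divide_distrib power2_eq_square)
      also have "(\<Sum>i\<in>UNIV. z $ i * z $ i) = (norm z)\<^sup>2"
        by (simp add: power2_norm_eq_inner inner_vec_def)
      also have "(norm z)\<^sup>2 / (norm z)\<^sup>2 = 1" using elim by simp
      finally have "(\<Sum>i\<in>UNIV - {i0}. (?Y i z)\<^sup>2) = 1 - (?Y i0 z)\<^sup>2"
        by (simp add: sum_diff1)
      then show ?case
        by (simp only: sum_distrib_left[symmetric] right_diff_distrib mult_1_right power_add)
    qed
  qed measurable
  also have "\<dots> = a (2 * j) - a (2 * j + 2)"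
    unfolding a_def by (rule Bochner_Integration.integral_diff) (rule int1)+
  finally have "real (CARD('n) - 1) * a (2 * j + 2) = (2 * real j + 1) * (a (2 * j) - a (2 * j + 2))" .
  moreover have "real (CARD('n) - 1) = real CARD('n) - 1" by (simp add: Suc_leI of_nat_diff)
  ultimately show ?thesis unfolding a by (simp add: algebra_simps)
qed

text \<open>The even moments satisfy the recurrence of the ultraspherical weight exactly when
  \<open>2 * m + 3\<close> is the dimension; the odd ones vanish on both sides.\<close>

lemma integral_cosine_power_eq_sphere_mean:
  fixes u :: "real ^ 'n"
  assumes u: "norm u = 1" and d: "CARD('n) = 2 * m + 3"
  shows "(\<integral>z. (u \<bullet> z / norm z) ^ k \<partial>P) = sphere_mean m (\<lambda>x. x ^ k)"
proof (cases "odd k")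
  case True
  then show ?thesis by (simp add: integral_cosine_odd_power sphere_mean_odd_power)
next
  case False
  then obtain j where k: "k = 2 * j" by (auto elim: evenE)
  have "(\<integral>z. (u \<bullet> z / norm z) ^ (2 * j) \<partial>P) = sphere_mean m (\<lambda>x. x ^ (2 * j))"
  proof (induction j)
    case 0
    show ?case by (simp add: sphere_mean_one prob_space)
  next
    case (Suc j)
    let ?c = "2 * real j + real CARD('n)"
    have "?c * (\<integral>z. (u \<bullet> z / norm z) ^ (2 * j + 2) \<partial>P) = ?c * sphere_mean m (\<lambda>x. x ^ (2 * j + 2))"
      using integral_cosine_power_recurrence[OF u, of j] sphere_mean_power_recurrence[of "2 * j + 1" m] Suc
      by (simp add: d algebra_simps)
    moreover have "?c \<noteq> 0" by (simp add: d)
    ultimately show ?case by simp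
  qed
  then show ?thesis by (simp add: k)
qed

lemma integral_cosine_eq_sphere_mean:
  fixes u :: "real ^ 'n"
  assumes u: "norm u = 1" and d: "CARD('n) = 2 * m + 3"
    and f: "continuous_on {-1..1} f" "f \<in> borel_measurable borel"
  shows "(\<integral>z. f (u \<bullet> z / norm z) \<partial>P) = sphere_mean m f"
  by (rule expectation_eq_sphere_mean[OF prob_space_axioms _ _ _ f])
     (use u cosine_range[of u] in \<open>auto simp: integral_cosine_power_eq_sphere_mean[OF u d]\<close>)

text \<open>
  The direction is uniform and independent of the norm. Take an independent copy \<open>w\<close> of \<open>z\<close> and
  replace \<open>u\<close> by the direction of \<open>w\<close>. For fixed \<open>w\<close> the expectation over \<open>z\<close> does not change, by
  symmetry; for fixed \<open>z\<close> the expectation over \<open>w\<close> involves only the cosine between \<open>w\<close> and the fixed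
  direction of \<open>z\<close>, whose law is known. Fubini's theorem equates the two.
\<close>

lemma integral_radius_cosine:
  fixes u :: "real ^ 'n" and K :: "real \<Rightarrow> real \<Rightarrow> real"
  assumes u: "norm u = 1" and d: "CARD('n) = 2 * m + 3"
    and K: "(\<lambda>(r, x). K r x) \<in> borel_measurable borel"
    and cont: "\<And>r. continuous_on {-1..1} (K r)"
    and mean: "(\<lambda>r. sphere_mean m (K r)) \<in> borel_measurable borel"
    and bound: "\<And>r x. x \<in> {-1..1} \<Longrightarrow> \<bar>K r x\<bar> \<le> B"
  shows "(\<integral>z. K (norm z) (u \<bullet> z / norm z) \<partial>P) = (\<integral>z. sphere_mean m (K (norm z)) \<partial>P)"
proof -
  interpret PP: pair_sigma_finite P P ..
  interpret PP: pair_prob_space P P ..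
  define k where "k w z = K (norm z) ((w /\<^sub>R norm w) \<bullet> z / norm z)" for w z :: "real ^ 'n"
  have "(\<lambda>(w, z). (norm z, (w /\<^sub>R norm w) \<bullet> z / norm z)) \<in> (P \<Otimes>\<^sub>M P) \<rightarrow>\<^sub>M (borel \<Otimes>\<^sub>M borel)"
    by measurable
  then have "(\<lambda>(w, z). (norm z, (w /\<^sub>R norm w) \<bullet> z / norm z)) \<in> borel_measurable (P \<Otimes>\<^sub>M P)"
    by (simp add: borel_prod)
  from measurable_compose[OF this K] have meas: "(\<lambda>(w, z). k w z) \<in> borel_measurable (P \<Otimes>\<^sub>M P)"
    by (simp add: k_def case_prod_beta)
  have "norm (w /\<^sub>R norm w) \<le> 1" for w :: "real ^ 'n" by (cases "w = 0") simp_all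
  then have "\<bar>k w z\<bar> \<le> B" for w z unfolding k_def by (intro bound cosine_range)
  then have int: "integrable (P \<Otimes>\<^sub>M P) (\<lambda>(w, z). k w z)"
    by (intro PP.integrable_const_bound[where B = B] meas) auto
  have slice_z: "AE w in P. (\<integral>z. k w z \<partial>P) = (\<integral>z. K (norm z) (u \<bullet> z / norm z) \<partial>P)"
    using AE_nonzero
  proof eventually_elim
    case (elim w)
    have "(\<lambda>(a, b). (b, a / b)) \<in> borel_measurable (borel :: (real \<times> real) measure)"
      unfolding borel_prod[symmetric] by measurable
    from measurable_compose[OF this K]
    have "(\<lambda>(a, b). K b (a / b)) \<in> borel_measurable borel"
      by (simp add: case_prod_beta borel_prod)
    then show ?case unfolding k_def
      by (intro integral_direction[where f = "\<lambda>a b. K b (a / b)"]) (use elim u in auto)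
  qed
  have slice_w: "AE z in P. (\<integral>w. k w z \<partial>P) = sphere_mean m (K (norm z))"
    using AE_nonzero
  proof eventually_elim
    case (elim z)
    have Kz: "K (norm z) \<in> borel_measurable borel"
    proof -
      have "(\<lambda>x. (norm z, x)) \<in> borel_measurable (borel :: real measure)"
        unfolding borel_prod[symmetric] by measurable
      from measurable_compose[OF this K] show ?thesis by simp
    qed
    have "k w z = K (norm z) ((z /\<^sub>R norm z) \<bullet> w / norm w)" for w
      by (simp add: k_def inner_commute divide_inverse mult_ac)
    then show ?case
      using integral_cosine_eq_sphere_mean[OF _ d cont Kz, of "z /\<^sub>R norm z"] elim by simp
  qed
  have [measurable]: "(\<lambda>w. \<integral>z. k w z \<partial>P) \<in> borel_measurable P"
    using meas by measurable
  have "(\<integral>z. K (norm z) (u \<bullet> z / norm z) \<partial>P) = (\<integral>w. (\<integral>z. K (norm z) (u \<bullet> z / norm z) \<partial>P) \<partial>P)"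
    by (simp add: prob_space)
  also have "\<dots> = (\<integral>w. (\<integral>z. k w z \<partial>P) \<partial>P)"
    using slice_z by (intro integral_cong_AE) auto
  also have "\<dots> = (\<integral>z. (\<integral>w. k w z \<partial>P) \<partial>P)" by (rule PP.Fubini_integral[OF int, symmetric])
  also have "\<dots> = (\<integral>z. sphere_mean m (K (norm z)) \<partial>P)"
  proof (rule integral_cong_AE)
    show "(\<lambda>z. \<integral>w. k w z \<partial>P) \<in> borel_measurable P" using meas by measurable
    show "(\<lambda>z. sphere_mean m (K (norm z))) \<in> borel_measurable P"
      using mean by measurable
  qed (rule slice_w)
  finally show ?thesis .
qed

end

section \<open>Negative moments of the norm\<close>

lemma bounded_density_near_origin_cball_mass:
  fixes P :: "(real ^ 'n::finite) measure"
  assumes "bounded_density_near_origin P"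
  obtains R C where "0 < R" "0 \<le> C"
    "\<And>r. 0 \<le> r \<Longrightarrow> r \<le> R \<Longrightarrow> emeasure P (cball 0 r) \<le> ennreal (C * r ^ CARD('n))"
proof -
  obtain U f C where U: "open U" "0 \<in> U" and f: "f \<in> borel_measurable borel"
    and bound: "\<And>x. x \<in> U \<Longrightarrow> 0 \<le> f x \<and> f x \<le> (C :: real)"
    and dens: "\<And>A. A \<in> sets borel \<Longrightarrow> A \<subseteq> U \<Longrightarrow> emeasure P A = (\<integral>\<^sup>+ x \<in> A. ennreal (f x) \<partial>lborel)"
    using assms unfolding bounded_density_near_origin_def by blast
  obtain R where R: "R > 0" "cball 0 R \<subseteq> U" using U open_contains_cball by blast
  have C: "0 \<le> C" using bound[OF U(2)] by linarith
  define V where "V = unit_ball_vol (real CARD('n))"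
  have V: "0 \<le> V" by (simp add: V_def)
  have "emeasure P (cball 0 r) \<le> ennreal (C * V * r ^ CARD('n))" if r: "0 \<le> r" "r \<le> R" for r
  proof -
    have sub: "cball 0 r \<subseteq> U" using r R(2) by (meson order_trans subset_cball)
    have "emeasure P (cball 0 r) = (\<integral>\<^sup>+ x \<in> cball 0 r. ennreal (f x) \<partial>lborel)"
      by (rule dens) (use sub in auto)
    also have "\<dots> \<le> (\<integral>\<^sup>+ x \<in> (cball 0 r :: (real ^ 'n) set). ennreal C \<partial>lborel)"
      using sub bound by (intro nn_integral_mono) (auto simp: indicator_def intro!: ennreal_leI)
    also have "\<dots> = ennreal C * emeasure lborel (cball 0 r :: (real ^ 'n) set)"
      by (simp add: nn_integral_cmult_indicator)
    also have "\<dots> = ennreal C * ennreal (V * r ^ CARD('n))"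
      using r by (simp add: emeasure_cball V_def)
    also have "\<dots> = ennreal (C * V * r ^ CARD('n))"
      using C V r by (simp add: ennreal_mult[symmetric] mult.assoc)
    finally show ?thesis .
  qed
  then show ?thesis using R(1) C V by (intro that[of R "C * V"]) auto
qed

lemma AE_nonzero_of_cball_mass:
  fixes P :: "(real ^ 'n::finite) measure"
  assumes sets: "sets P = sets borel" and "bounded_density_near_origin P"
  shows "AE z in P. z \<noteq> 0"
proof -
  obtain R C where "0 < R" and *:
    "\<And>r. 0 \<le> r \<Longrightarrow> r \<le> R \<Longrightarrow> emeasure P (cball 0 r) \<le> ennreal (C * r ^ CARD('n))"
    using bounded_density_near_origin_cball_mass[OF assms(2)] by metis
  have "emeasure P {0} = 0" using *[of 0] \<open>0 < R\<close> by (simp add: power_0_left)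
  then have "{0} \<in> null_sets P" using sets by auto
  then show ?thesis by (rule AE_I'[where N = "{0}"]) auto
qed

text \<open>
  Cut a small ball into the dyadic shells \<open>R / 2 ^ (n + 1) < norm z \<le> R / 2 ^ n\<close>. On the \<open>n\<close>-th shell
  the integrand is at most \<open>(2 ^ (n + 1) / R) ^ k\<close> and the mass is of order at most \<open>(R / 2 ^ n) ^ d\<close>, so for
  \<open>k < d\<close> the contributions decay geometrically. Away from the ball the integrand is bounded.
\<close>

lemma integrable_inverse_norm_power:
  fixes P :: "(real ^ 'n::finite) measure"
  assumes "prob_space P" and sets: "sets P = sets borel"
    and dens: "bounded_density_near_origin P" and k: "k < CARD('n)"
  shows "integrable P (\<lambda>z. 1 / norm z ^ k)"
proof -
  interpret prob_space P by fact
  note sets[measurable_cong]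
  let ?d = "CARD('n)"
  obtain R C where R: "0 < R" and C: "0 \<le> C" and mass:
    "\<And>r. 0 \<le> r \<Longrightarrow> r \<le> R \<Longrightarrow> emeasure P (cball 0 r) \<le> ennreal (C * r ^ CARD('n))"
    using bounded_density_near_origin_cball_mass[OF dens] by metis
  define r where "r n = R / 2 ^ n" for n :: nat
  have r_pos: "0 < r n" "r n \<le> R" for n
    using R by (auto simp: r_def divide_le_eq mult_le_cancel_left1)
  define g where "g n z = ennreal (1 / r (Suc n) ^ k) * indicator (cball 0 (r n)) z" for n and z :: "real ^ 'n"
  have [measurable]: "cball 0 (r n) \<in> sets P" for n by (simp add: sets)
  have [measurable]: "g n \<in> borel_measurable P" for n unfolding g_def by measurable
  \<comment> \<open>The shells may be enlarged to closed balls, whose mass is already bounded.\<close>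
  have le: "ennreal (1 / norm z ^ k) \<le> ennreal (1 / R ^ k) + (\<Sum>n. g n z)" if "z \<noteq> 0" for z
  proof (cases "norm z \<le> R")
    case False
    then have "1 / norm z ^ k \<le> 1 / R ^ k"
      using R by (intro divide_left_mono power_mono mult_pos_pos zero_less_power) auto
    then show ?thesis by (meson ennreal_leI le_iff_add order_trans)
  next
    case True
    have "r \<longlonglongrightarrow> 0"
      unfolding r_def[abs_def] by (rule LIMSEQ_divide_realpow_zero) simp
    from order_tendstoD(2)[OF this, of "norm z"] have "\<forall>\<^sub>F n in sequentially. r n < norm z"
      using \<open>z \<noteq> 0\<close> by simp
    then have "\<exists>n. r n < norm z" by (auto simp: eventually_sequentially)
    then obtain n where n: "r n < norm z" "\<And>j. j < n \<Longrightarrow> \<not> r j < norm z"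
      using exists_least_iff[of "\<lambda>n. r n < norm z"] by auto
    have "n \<noteq> 0" using n(1) True by (cases n) (auto simp: r_def)
    then obtain j where j: "n = Suc j" by (cases n) auto
    have "1 / norm z ^ k \<le> 1 / r (Suc j) ^ k"
      using n(1) r_pos[of "Suc j"] j
      by (intro divide_left_mono power_mono mult_pos_pos zero_less_power) auto
    then have "ennreal (1 / norm z ^ k) \<le> g j z"
      using n(2)[of j] j by (auto simp: g_def intro!: ennreal_leI)
    also have "g j z = (\<Sum>n\<in>{j}. g n z)" by simp
    also have "\<dots> \<le> (\<Sum>n. g n z)" by (rule sum_le_suminf) auto
    finally show ?thesis by (simp add: add_increasing)
  qed
  have shell: "(\<integral>\<^sup>+ z. g n z \<partial>P) \<le> ennreal (C * 2 ^ k * R ^ (?d - k) * (1/2) ^ n)" for n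
  proof -
    have "(\<integral>\<^sup>+ z. g n z \<partial>P) = ennreal (1 / r (Suc n) ^ k) * emeasure P (cball 0 (r n))"
      unfolding g_def by (simp add: nn_integral_cmult_indicator sets)
    also have "\<dots> \<le> ennreal (1 / r (Suc n) ^ k) * ennreal (C * r n ^ ?d)"
      using r_pos[of n] by (intro mult_left_mono mass) auto
    also have "\<dots> = ennreal (1 / r (Suc n) ^ k * (C * r n ^ ?d))"
      using r_pos[of "Suc n"] r_pos[of n] C by (intro ennreal_mult[symmetric]) auto
    also have "1 / r (Suc n) ^ k * (C * r n ^ ?d) = C * 2 ^ k * r n ^ (?d - k)"
    proof -
      have "r n = 2 * r (Suc n)" by (simp add: r_def)
      moreover have "r n ^ ?d = r n ^ k * r n ^ (?d - k)"
        using k by (simp add: power_add[symmetric])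
      ultimately show ?thesis using r_pos[of "Suc n"] by (simp add: power_mult_distrib)
    qed
    also have "\<dots> \<le> C * 2 ^ k * (R ^ (?d - k) * (1/2) ^ n)"
    proof -
      have "(1 / 2 ^ n) ^ (?d - k) \<le> (1 / 2 ^ n :: real) ^ 1"
        by (rule power_decreasing) (use k in \<open>auto simp: divide_le_eq_1\<close>)
      then have "R ^ (?d - k) * (1 / 2 ^ n) ^ (?d - k) \<le> R ^ (?d - k) * (1 / 2 ^ n) ^ 1"
        by (rule mult_left_mono) (use R in simp)
      moreover have "r n ^ (?d - k) = R ^ (?d - k) * (1 / 2 ^ n) ^ (?d - k)"
        unfolding power_mult_distrib[symmetric] by (simp add: r_def)
      ultimately have "r n ^ (?d - k) \<le> R ^ (?d - k) * (1/2) ^ n"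
        by (simp add: power_one_over)
      then show ?thesis using C by (intro mult_left_mono) auto
    qed
    finally show ?thesis by (simp add: mult.assoc ennreal_leI)
  qed
  have "(\<integral>\<^sup>+ z. ennreal (1 / norm z ^ k) \<partial>P) \<le> (\<integral>\<^sup>+ z. ennreal (1 / R ^ k) + (\<Sum>n. g n z) \<partial>P)"
  proof (rule nn_integral_mono_AE)
    show "AE z in P. ennreal (1 / norm z ^ k) \<le> ennreal (1 / R ^ k) + (\<Sum>n. g n z)"
      using AE_nonzero_of_cball_mass[OF sets dens] by eventually_elim (rule le)
  qed
  also have "\<dots> = ennreal (1 / R ^ k) + (\<Sum>n. \<integral>\<^sup>+ z. g n z \<partial>P)"
    by (subst nn_integral_add) (simp_all add: nn_integral_suminf emeasure_space_1)
  also have "(\<Sum>n. \<integral>\<^sup>+ z. g n z \<partial>P) \<le> (\<Sum>n. ennreal (C * 2 ^ k * R ^ (?d - k) * (1/2) ^ n))"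
    by (intro suminf_le shell) auto
  also have "\<dots> = ennreal (\<Sum>n. C * 2 ^ k * R ^ (?d - k) * (1/2) ^ n)"
    using C R by (intro suminf_ennreal2 summable_mult) auto
  finally have "(\<integral>\<^sup>+ z. ennreal (1 / norm z ^ k) \<partial>P) < \<infinity>"
    by (rule order_le_less_trans) (simp_all add: add_left_mono)
  then show ?thesis
    by (intro integrableI_bounded) (auto simp: abs_divide)
qed

section \<open>The geometric distribution function\<close>

lemma sphere_mean_kernel_expansion:
  "\<exists>w. \<forall>t\<in>{0<..<1}. sphere_mean m (sphere_kernel t) = (\<Sum>i=0..m. w i * t ^ (2 * i + 1))"
proof -
  obtain w where "\<forall>t\<in>{0<..<1}. integral {-1..1} (\<lambda>x. sphere_kernel t x * (1 - x\<^sup>2) ^ m) =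
     (\<Sum>i=0..m. w i * t ^ (2 * i + 1))"
    using sphere_kernel_integral_expansion by blast
  then show ?thesis
    by (intro exI[of _ "\<lambda>i. w i / integral {-1..1} (\<lambda>x. (1 - x\<^sup>2) ^ m)"])
       (simp add: sphere_mean_def sum_divide_distrib)
qed

lemma abs_sphere_mean_kernel_le: "\<bar>sphere_mean m (sphere_kernel t)\<bar> \<le> 1"
  using sphere_mean_diff_le[OF continuous_on_sphere_kernel continuous_on_const[of _ 0], of t 1 m]
  by (simp add: abs_sphere_kernel_le sphere_mean_def)

lemma measurable_sphere_mean_kernel [measurable]:
  "(\<lambda>t. sphere_mean m (sphere_kernel t)) \<in> borel_measurable borel"
  by (intro borel_measurable_continuous_onI continuous_on_sphere_mean_kernel)

lemma measurable_sphere_kernel: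
  "(\<lambda>(r, x). sphere_kernel (s / r) x) \<in> borel_measurable borel"
  unfolding borel_prod[symmetric] sphere_kernel_def by measurable

text \<open>Dividing numerator and denominator by \<open>norm z\<close> leaves the ratio of the norms and the cosine.
  If \<open>z = s u\<close>, both sides are \<open>0\<close> by the convention for division by zero.\<close>

lemma inner_unit_difference:
  fixes u z :: "'a::real_inner"
  assumes u: "norm u = 1" and z: "z \<noteq> 0"
  shows "u \<bullet> ((1 / norm (s *\<^sub>R u - z)) *\<^sub>R (s *\<^sub>R u - z)) =
    sphere_kernel (s / norm z) (u \<bullet> z / norm z)"
proof -
  have uu: "u \<bullet> u = 1" using u by (simp add: dot_square_norm)
  have "(norm (s *\<^sub>R u - z) / norm z)\<^sup>2 = 1 - 2 * (s / norm z) * (u \<bullet> z / norm z) + (s / norm z)\<^sup>2"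
  proof -
    have "(norm (s *\<^sub>R u - z))\<^sup>2 = s\<^sup>2 - 2 * s * (u \<bullet> z) + (norm z)\<^sup>2"
      unfolding power2_norm_eq_inner
      by (simp add: inner_diff_left inner_diff_right inner_commute uu power2_eq_square)
    then show ?thesis using z
      by (simp add: power_divide add_divide_distrib diff_divide_distrib power2_eq_square)
  qed
  then have "chord (s / norm z) (u \<bullet> z / norm z) = norm (s *\<^sub>R u - z) / norm z"
    by (metis norm_ge_zero divide_nonneg_nonneg real_sqrt_unique)
  then have "sphere_kernel (s / norm z) (u \<bullet> z / norm z) =
      ((s - u \<bullet> z) / norm z) / (norm (s *\<^sub>R u - z) / norm z)"
    by (simp add: sphere_kernel_def diff_divide_distrib)
  also have "\<dots> = (s - u \<bullet> z) / norm (s *\<^sub>R u - z)" using z by simp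
  finally show ?thesis by (simp add: inner_diff_right uu)
qed

context spherical_law
begin

lemma geometric_cdf_unfold:
  "geometric_cdf P x = (\<integral>z. (1 / norm (x - z)) *\<^sub>R (x - z) \<partial>P)"
  unfolding geometric_cdf_def by (intro Bochner_Integration.integral_cong) auto

lemma integrable_unit_difference: "integrable P (\<lambda>z. (1 / norm (x - z)) *\<^sub>R (x - z))"
  by (rule integrable_const_bound[where B = 1]) (auto intro!: AE_I2)

text \<open>The reflection \<open>T x = 2 (u \<bullet> x) u - x\<close> fixes \<open>u\<close>, so by invariance of the law it fixes the value at
  \<open>s u\<close>; its fixed points are the multiples of \<open>u\<close>.\<close>

lemma geometric_cdf_parallel:
  assumes u: "norm u = 1"
  shows "geometric_cdf P (s *\<^sub>R u) = (u \<bullet> geometric_cdf P (s *\<^sub>R u)) *\<^sub>R u"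
proof -
  have uu: "u \<bullet> u = 1" using u by (simp add: dot_square_norm)
  define T where "T x = (2 * (u \<bullet> x)) *\<^sub>R u - x" for x
  define g where "g z = (1 / norm (s *\<^sub>R u - z)) *\<^sub>R (s *\<^sub>R u - z)" for z
  define F where "F = geometric_cdf P (s *\<^sub>R u)"
  have lin: "linear T"
    by (rule linearI) (simp_all add: T_def inner_add_right algebra_simps)
  have T: "orthogonal_transformation T"
    unfolding orthogonal_transformation_def
  proof (intro conjI allI lin)
    show "T v \<bullet> T w = v \<bullet> w" for v w
      by (simp add: T_def inner_diff_left inner_diff_right uu inner_commute)
  qed
  have "T u = u" by (simp add: T_def uu scaleR_2)
  have gT: "g (T z) = T (g z)" for z
  proof -
    have *: "s *\<^sub>R u - T z = T (s *\<^sub>R u - z)"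
      by (simp add: linear_diff[OF lin] linear_cmul[OF lin] \<open>T u = u\<close>)
    show ?thesis unfolding g_def *
      by (simp add: linear_cmul[OF lin] orthogonal_transformation_norm[OF T])
  qed
  have meas: "g \<in> borel_measurable borel" unfolding g_def by measurable
  have "F = (\<integral>z. g (T z) \<partial>P)"
    by (simp add: F_def geometric_cdf_unfold g_def[symmetric] integral_orthogonal[OF T meas])
  also have "\<dots> = T (\<integral>z. g z \<partial>P)"
    unfolding gT using lin integrable_unit_difference[of "s *\<^sub>R u"]
    by (intro integral_bounded_linear) (simp_all add: linear_conv_bounded_linear g_def)
  also have "\<dots> = (2 * (u \<bullet> F)) *\<^sub>R u - F"
    by (simp add: T_def F_def geometric_cdf_unfold g_def)
  finally have "2 *\<^sub>R F = 2 *\<^sub>R ((u \<bullet> F) *\<^sub>R u)"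
    by (simp add: scaleR_2 algebra_simps)
  then have "F = (u \<bullet> F) *\<^sub>R u" by (rule scaleR_left_imp_eq[rotated]) simp
  then show ?thesis by (simp only: F_def)
qed

lemma geometric_cdf_radial:
  fixes u :: "real ^ 'n"
  assumes u: "norm u = 1" and d: "CARD('n) = 2 * m + 3"
  shows "geometric_cdf P (s *\<^sub>R u) = (\<integral>z. sphere_mean m (sphere_kernel (s / norm z)) \<partial>P) *\<^sub>R u"
proof -
  have "u \<bullet> geometric_cdf P (s *\<^sub>R u) =
      (\<integral>z. u \<bullet> ((1 / norm (s *\<^sub>R u - z)) *\<^sub>R (s *\<^sub>R u - z)) \<partial>P)"
    unfolding geometric_cdf_unfold by (rule integral_inner_right[symmetric]) (rule integrable_unit_difference)
  also have "\<dots> = (\<integral>z. sphere_kernel (s / norm z) (u \<bullet> z / norm z) \<partial>P)"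
    using AE_nonzero inner_unit_difference[OF u]
    by (intro integral_cong_AE) (auto simp: sphere_kernel_def elim!: eventually_mono)
  also have "\<dots> = (\<integral>z. sphere_mean m (sphere_kernel (s / norm z)) \<partial>P)"
    by (rule integral_radius_cosine[OF u d measurable_sphere_kernel continuous_on_sphere_kernel _
          abs_sphere_kernel_le]) measurable
  finally show ?thesis by (subst geometric_cdf_parallel[OF u]) simp
qed

end

theorem proposition5p3:
  assumes "odd CARD('n::finite)" and "CARD('n) \<ge> 3"
  shows "\<exists>(w :: nat \<Rightarrow> real) (p :: real \<Rightarrow> real). continuous_on {0<..1} p \<and>
    (\<forall>P :: (real ^ 'n) measure.
       prob_space P \<and> sets P = sets borel \<and>
       spherically_symmetric P \<and> bounded_density_near_origin P \<longrightarrow>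
       (\<forall>s > 0. \<forall>u \<in> sphere 0 1.
          (\<forall>i \<in> {0..(CARD('n) - 3) div 2}. integrable P (\<lambda>z. 1 / norm z ^ (2 * i + 1))) \<and>
          integrable P (\<lambda>z. p (norm z / s) * indicator {z. norm z \<le> s} z) \<and>
          geometric_cdf P (s *\<^sub>R u) =
            ((\<Sum>i = 0..(CARD('n) - 3) div 2.
                (\<integral>z. 1 / norm z ^ (2 * i + 1) \<partial>P) * w i * s ^ (2 * i + 1)) +
             (\<integral>z. p (norm z / s) * indicator {z. norm z \<le> s} z \<partial>P)) *\<^sub>R u))"
proof -
  define m where "m = (CARD('n) - 3) div 2"
  have d: "CARD('n) = 2 * m + 3" using assms unfolding m_def by presburger
  define G where "G t = sphere_mean m (sphere_kernel t)" for t
  obtain w where w: "\<And>t. t \<in> {0<..<1} \<Longrightarrow> G t = (\<Sum>i=0..m. w i * t ^ (2 * i + 1))"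
    using sphere_mean_kernel_expansion[of m] unfolding G_def by blast
  define S where "S t = (\<Sum>i=0..m. w i * t ^ (2 * i + 1))" for t :: real
  define p where "p \<rho> = G (1 / \<rho>) - S (1 / \<rho>)" for \<rho>
  have G: "continuous_on UNIV G" unfolding G_def by (rule continuous_on_sphere_mean_kernel)
  have "continuous_on {0<..1} p"
    unfolding p_def S_def
    by (intro continuous_intros continuous_on_compose2[OF G]) auto
  moreover have "(\<forall>i \<in> {0..m}. integrable P (\<lambda>z. 1 / norm z ^ (2 * i + 1))) \<and>
      integrable P (\<lambda>z. p (norm z / s) * indicator {z. norm z \<le> s} z) \<and>
      geometric_cdf P (s *\<^sub>R u) =
        ((\<Sum>i = 0..m. (\<integral>z. 1 / norm z ^ (2 * i + 1) \<partial>P) * w i * s ^ (2 * i + 1)) +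
         (\<integral>z. p (norm z / s) * indicator {z. norm z \<le> s} z \<partial>P)) *\<^sub>R u"
    if P: "prob_space P" "sets P = sets borel" "spherically_symmetric P" "bounded_density_near_origin P"
      and s: "s > 0" and "u \<in> sphere 0 1"
    for P :: "(real ^ 'n) measure" and s u
  proof (intro conjI)
    interpret spherical_law P
      by (intro spherical_law.intro spherical_law_axioms.intro P AE_nonzero_of_cball_mass)
    have u: "norm u = 1" using that by simp
    show inv: "\<forall>i \<in> {0..m}. integrable P (\<lambda>z. 1 / norm z ^ (2 * i + 1))"
    proof
      show "integrable P (\<lambda>z. 1 / norm z ^ (2 * i + 1))" if "i \<in> {0..m}" for i
        by (rule integrable_inverse_norm_power[OF P(1,2,4)]) (use that d in simp)
    qed
    have S_eq: "S (s / norm z) = (\<Sum>i=0..m. (w i * s ^ (2 * i + 1)) * (1 / norm z ^ (2 * i + 1)))" for z :: "real ^ 'n"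
      by (simp only: S_def power_divide times_divide_eq_right mult_1_right)
    have S_int: "integrable P (\<lambda>z. S (s / norm z))"
      unfolding S_eq using inv by (intro Bochner_Integration.integrable_sum integrable_mult_right) blast
    have G_int: "integrable P (\<lambda>z. G (s / norm z))"
      unfolding G_def by (rule integrable_const_bound[where B = 1])
        (auto intro!: AE_I2 abs_sphere_mean_kernel_le)
    have p_eq: "p (norm z / s) = G (s / norm z) - S (s / norm z)" for z :: "real ^ 'n"
      by (simp add: p_def)
    show p_int: "integrable P (\<lambda>z. p (norm z / s) * indicator {z. norm z \<le> s} z)"
    proof (rule integrable_real_mult_indicator)
      show "{z. norm z \<le> s} \<in> sets P" by measurable
    qed (use G_int S_int in \<open>simp add: p_eq\<close>)
    \<comment> \<open>Pointwise everywhere: where \<open>norm z > s\<close> the ratio lies in \<open>(0, 1)\<close> and \<open>G\<close> is the polynomial \<open>S\<close>;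
      elsewhere, the origin included, the identity is the definition of \<open>p\<close>.\<close>
    have split: "G (s / norm z) = S (s / norm z) + p (norm z / s) * indicator {z. norm z \<le> s} z" for z :: "real ^ 'n"
    proof (cases "norm z \<le> s")
      case False
      then have "0 < norm z" using s by linarith
      then have "s / norm z \<in> {0<..<1}" using False s by simp
      then show ?thesis using False w by (simp add: S_def)
    qed (simp add: p_eq)
    have "(\<integral>z. G (s / norm z) \<partial>P) = (\<integral>z. S (s / norm z) \<partial>P) +
        (\<integral>z. p (norm z / s) * indicator {z. norm z \<le> s} z \<partial>P)"
      unfolding split by (rule Bochner_Integration.integral_add[OF S_int p_int])
    also have "(\<integral>z. S (s / norm z) \<partial>P) =
        (\<Sum>i = 0..m. (\<integral>z. 1 / norm z ^ (2 * i + 1) \<partial>P) * w i * s ^ (2 * i + 1))"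
    proof -
      have "(\<integral>z. S (s / norm z) \<partial>P) =
          (\<Sum>i = 0..m. \<integral>z. (w i * s ^ (2 * i + 1)) * (1 / norm z ^ (2 * i + 1)) \<partial>P)"
        unfolding S_eq using inv
        by (intro Bochner_Integration.integral_sum integrable_mult_right) blast
      also have "\<dots> = (\<Sum>i = 0..m. (\<integral>z. 1 / norm z ^ (2 * i + 1) \<partial>P) * w i * s ^ (2 * i + 1))"
        unfolding integral_mult_right_zero by (simp only: mult_ac)
      finally show ?thesis .
    qed
    finally show "geometric_cdf P (s *\<^sub>R u) =
        ((\<Sum>i = 0..m. (\<integral>z. 1 / norm z ^ (2 * i + 1) \<partial>P) * w i * s ^ (2 * i + 1)) +
         (\<integral>z. p (norm z / s) * indicator {z. norm z \<le> s} z \<partial>P)) *\<^sub>R u"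
      by (simp add: geometric_cdf_radial[OF u d] G_def)
  qed
  ultimately show ?thesis
    unfolding m_def[symmetric] by (intro exI[of _ w] exI[of _ p]) blast
qed

end
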